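(* Let $\tau\in\mathbb{C}$ with $\operatorname{Im}(\tau)>0$, $q=e^{2\pi i\tau}$ and $q^{1/8}=e^{2\pi i\tau/8}$. Then the following two identities hold: (1) $\displaystyle \frac{\eta(6\tau)\,\eta(9\tau)^2}{\eta(3\tau)\,\eta(18\tau)}=q^{1/8}\sum_{n=0}^{\infty}\left(\frac{n+2}{3}\right)^2q^{\frac{n(n+1)}{2}}$; (2) $\displaystyle \frac{\eta(\tau)^2\,\eta(6\tau)}{\eta(2\tau)\,\eta(3\tau)}=q^{1/8}\sum_{n=0}^{\infty}\left[3\left(\frac{n+2}{3}\right)^2-2\right]q^{\frac{n(n+1)}{2}}$.
   Context: For $\operatorname{Im}(\tau)>0$ and $q=e^{2\pi i\tau}$, Dedekind's eta function is $\eta(\tau)=q^{1/24}\prod_{n=1}^{\infty}(1-q^n)$, where $q^{1/24}=e^{2\pi i\tau/24}$; $\eta(k\tau)^j$ denotes the $j$-th power of $\eta(k\tau)$. The symbol $\left(\frac{a}{3}\right)$ is the Legendre symbol modulo $3$: it equals $0$, $1$, $-1$ according as $a\equiv 0,1,2\pmod 3$; so $\left(\frac{n+2}{3}\right)$ is a Legendre symbol, not a fraction. *)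

theory Defs
  imports "HOL-Analysis.Analysis" "HOL-Number_Theory.Number_Theory"
begin

text \<open>
  The factor for the product index \<open>n \<ge> 1\<close> is written with \<open>Suc n\<close>, since \<open>prodinf\<close> starts at 0.
  The definition is meaningful for \<open>Im \<tau> > 0\<close> only.
\<close>
definition dedekind_eta :: "complex \<Rightarrow> complex" where
  "dedekind_eta \<tau> =
     exp (2 * of_real pi * \<i> * \<tau> / 24) * (\<Prod>n. 1 - exp (2 * of_real pi * \<i> * \<tau>) ^ Suc n)"

lemma norm_nome_less_1:
  assumes "Im \<tau> > 0"
  shows "norm (exp (2 * of_real pi * \<i> * \<tau>)) < 1"
  using assms by (simp add: norm_exp_eq_Re)

text \<open>The product converges, and the eta function has no zeros in the upper half-plane.\<close>

lemma convergent_prod_dedekind_eta: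
  assumes "Im \<tau> > 0"
  shows "convergent_prod (\<lambda>n. 1 - exp (2 * of_real pi * \<i> * \<tau>) ^ Suc n)"
proof -
  define q where "q = exp (2 * of_real pi * \<i> * \<tau>)"
  have q: "norm q < 1"
    using norm_nome_less_1[OF assms] by (simp add: q_def)
  have "summable (\<lambda>n. norm q * norm q ^ n)"
    using q by (intro summable_mult summable_geometric) simp
  hence "summable (\<lambda>n. norm ((1 - q ^ Suc n) - 1))"
    by (simp add: norm_mult norm_power)
  thus ?thesis
    unfolding q_def[symmetric]
    by (intro abs_convergent_prod_imp_convergent_prod) (simp add: abs_convergent_prod_conv_summable)
qed

lemma dedekind_eta_nonzero:
  assumes "Im \<tau> > 0"
  shows "dedekind_eta \<tau> \<noteq> 0"
proof -
  define q where "q = exp (2 * of_real pi * \<i> * \<tau>)"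
  have q: "norm q < 1"
    using norm_nome_less_1[OF assms] by (simp add: q_def)
  have "1 - q ^ Suc n \<noteq> 0" for n
  proof
    assume "1 - q ^ Suc n = 0"
    hence "norm (q ^ Suc n) = 1" by simp
    moreover have "norm q ^ Suc n < 1"
      using q by (intro power_Suc_less_one) (auto simp: q_def)
    ultimately show False by (simp add: norm_power del: power_Suc)
  qed
  hence "(\<Prod>n. 1 - q ^ Suc n) \<noteq> 0"
    using convergent_prod_dedekind_eta[OF assms]
    by (intro prodinf_nonzero) (simp_all add: q_def)
  thus ?thesis
    by (simp add: dedekind_eta_def q_def)
qed

end

theory Submission
  imports Defs
begin

text \<open>
  Folding \<open>n\<close> and \<open>-n-1\<close> together, the Jacobi triple product reads
  \<open>\<Sum>m\<ge>0. q^(m(m+1)/2) (z^m + z^(-m-1)) = \<Prod>n\<ge>1. (1 - q^n) (1 + z q^n) (1 + z^(-1) q^(n-1))\<close>.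
  Both identities are instances. For (1), take base \<open>q^9\<close> and \<open>z = q^(-3)\<close>: the two powers in the
  \<open>m\<close>-th term are the triangular powers of index \<open>3m\<close> and \<open>3m+2\<close>. For (2), take \<open>z\<close> a primitive
  cube root of unity \<open>\<omega>\<close>: the coefficients \<open>\<omega>^m + \<omega>^(-m-1)\<close> are \<open>-\<omega>\<close> times the periodic
  sequence \<open>1, -2, 1\<close>, and \<open>(1 + \<omega> x) (1 + \<omega>\<^sup>2 x) = (1 + x^3) / (1 + x)\<close> evaluates the product.
\<close>

section \<open>The q-binomial theorem\<close>

text \<open>The q-Pochhammer symbol (a; q)_n. Exponents start at 0, so Euler's product of 1 - q^n
  over n \<ge> 1 is the case a = q.\<close>

definition qpoch :: "complex \<Rightarrow> complex \<Rightarrow> nat \<Rightarrow> complex" where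
  "qpoch a q n = (\<Prod>k<n. 1 - a * q ^ k)"

definition qpoch_inf :: "complex \<Rightarrow> complex \<Rightarrow> complex" where
  "qpoch_inf a q = (\<Prod>k. 1 - a * q ^ k)"

lemma qpoch_0 [simp]: "qpoch a q 0 = 1"
  by (simp add: qpoch_def)

lemma qpoch_Suc: "qpoch a q (Suc n) = qpoch a q n * (1 - a * q ^ n)"
  by (simp add: qpoch_def)

lemma convergent_prod_qpoch:
  fixes a q :: complex
  assumes "norm q < 1"
  shows "convergent_prod (\<lambda>k. 1 - a * q ^ k)"
proof -
  have "summable (\<lambda>k. norm a * norm q ^ k)"
    using assms by (intro summable_mult summable_geometric) simp
  thus ?thesis
    by (intro abs_convergent_prod_imp_convergent_prod)
       (simp add: abs_convergent_prod_conv_summable norm_mult norm_power)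
qed

lemma qpoch_tendsto:
  assumes "norm q < 1"
  shows "qpoch a q \<longlonglongrightarrow> qpoch_inf a q"
  using convergent_prod_LIMSEQ[OF convergent_prod_qpoch[OF assms, of a]]
  unfolding qpoch_def qpoch_inf_def by (subst LIMSEQ_lessThan_iff_atMost)

lemma one_minus_mult_power_nonzero:
  fixes a q :: complex
  assumes "norm q < 1" "norm a < 1"
  shows "1 - a * q ^ k \<noteq> 0"
proof
  assume "1 - a * q ^ k = 0"
  hence "norm (a * q ^ k) = 1" by simp
  moreover have "norm a * norm q ^ k \<le> norm a"
    using assms by (intro mult_left_le power_le_one) auto
  ultimately show False using assms(2) by (simp add: norm_mult norm_power)
qed

lemma qpoch_nonzero:
  assumes "norm q < 1" "norm a < 1"
  shows "qpoch a q n \<noteq> 0"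
  using one_minus_mult_power_nonzero[OF assms] by (simp add: qpoch_def)

lemma qpoch_inf_nonzero:
  assumes "norm q < 1" "norm a < 1"
  shows "qpoch_inf a q \<noteq> 0"
  unfolding qpoch_inf_def
  by (intro prodinf_nonzero convergent_prod_qpoch assms one_minus_mult_power_nonzero)

text \<open>The Gaussian binomial coefficient, as a quotient of complex numbers; for
  \<open>norm q < 1\<close> no denominator vanishes. The value 0 for k > n lets Pascal's rule hold
  at k = n as well.\<close>

definition qbinomial :: "complex \<Rightarrow> nat \<Rightarrow> nat \<Rightarrow> complex" where
  "qbinomial q n k =
     (if k \<le> n then qpoch q q n / (qpoch q q k * qpoch q q (n - k)) else 0)"

lemma qbinomial_0:
  assumes "norm q < 1"
  shows "qbinomial q n 0 = 1"
  using qpoch_nonzero[OF assms assms] by (simp add: qbinomial_def)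

lemma qbinomial_self:
  assumes "norm q < 1"
  shows "qbinomial q n n = 1"
  using qpoch_nonzero[OF assms assms] by (simp add: qbinomial_def)

lemma qbinomial_symmetric:
  assumes "k \<le> n"
  shows "qbinomial q n (n - k) = qbinomial q n k"
  using assms by (simp add: qbinomial_def mult.commute)

text \<open>The q-analogue of Pascal's rule. Over a common denominator, and with
  \<open>qpoch q q n\<close> taken out, the numerators are 1 - q^(n-k) and q^(n-k) (1 - q^(k+1)),
  which add up to 1 - q^(n+1).\<close>

lemma qbinomial_Suc_Suc:
  assumes "norm q < 1" "k \<le> n"
  shows "qbinomial q (Suc n) (Suc k) = qbinomial q n (Suc k) + q ^ (n - k) * qbinomial q n k"
proof (cases "k = n")
  case True
  thus ?thesis using qbinomial_self[OF assms(1)] by (simp add: qbinomial_def)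
next
  case False
  then obtain j where n: "n = k + Suc j"
    using assms(2) by (metis add_Suc_right le_neq_implies_less less_imp_Suc_add)
  have nz: "qpoch q q m \<noteq> 0" for m
    by (rule qpoch_nonzero[OF assms(1) assms(1)])
  have nz': "1 - q * q ^ m \<noteq> 0" for m
    by (rule one_minus_mult_power_nonzero[OF assms(1) assms(1)])
  have "n - k = Suc j" "n - Suc k = j" "Suc n - Suc k = Suc j"
    using n by auto
  hence "qbinomial q n (Suc k) + q ^ (n - k) * qbinomial q n k =
    qpoch q q n / (qpoch q q (Suc k) * qpoch q q j) +
    q ^ Suc j * (qpoch q q n / (qpoch q q k * qpoch q q (Suc j)))"
    using n by (simp add: qbinomial_def)
  also have "\<dots> = qpoch q q n * ((1 - q * q ^ j) + q ^ Suc j * (1 - q * q ^ k)) /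
      (qpoch q q (Suc k) * qpoch q q (Suc j))"
    using nz nz' unfolding qpoch_Suc by (simp add: divide_simps) (simp add: algebra_simps)
  also have "(1 - q * q ^ j) + q ^ Suc j * (1 - q * q ^ k) = 1 - q * q ^ n"
    by (simp add: n algebra_simps power_add)
  also have "qpoch q q n * (1 - q * q ^ n) = qpoch q q (Suc n)"
    by (simp add: qpoch_Suc)
  also have "qpoch q q (Suc n) / (qpoch q q (Suc k) * qpoch q q (Suc j)) =
      qbinomial q (Suc n) (Suc k)"
    using n by (simp add: qbinomial_def)
  finally show ?thesis ..
qed

text \<open>Induction on the number of factors: the new factor x + y q^n splits the sum in two, and
  Pascal's rule recombines the parts.\<close>

theorem q_binomial_theorem:
  fixes x y q :: complex
  assumes "norm q < 1"
  shows "(\<Prod>k<n. x + y * q ^ k) =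
    (\<Sum>k\<le>n. q ^ (k choose 2) * qbinomial q n k * y ^ k * x ^ (n - k))"
proof (induction n)
  case 0
  show ?case using qbinomial_0[OF assms, of 0] by (simp add: numeral_2_eq_2)
next
  case (Suc n)
  define c where "c = (\<lambda>n k. q ^ (k choose 2) * qbinomial q n k)"
  have c0: "c m 0 = 1" for m
    using qbinomial_0[OF assms] by (simp add: c_def numeral_2_eq_2)
  \<comment> \<open>The binomial exponent grows by k from k to k + 1, so the weight q^(n-k) of
    Pascal's rule turns into q^n, the power carried by the new factor.\<close>
  have cS: "c (Suc n) (Suc k) = c n (Suc k) + q ^ n * c n k" if "k \<le> n" for k
  proof -
    have "q ^ (Suc k choose 2) * q ^ (n - k) = q ^ n * q ^ (k choose 2)"
      using that by (simp add: numeral_2_eq_2 add.commute flip: power_add)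
    thus ?thesis using qbinomial_Suc_Suc[OF assms that]
      by (simp add: c_def algebra_simps)
  qed
  \<comment> \<open>This zero coefficient lets the first sum run up to \<open>Suc n\<close>;
    splitting off k = 0 then aligns it with the second.\<close>
  have cn: "c n (Suc n) = 0" by (simp add: c_def qbinomial_def)
  have "(\<Prod>k<Suc n. x + y * q ^ k) = (\<Sum>k\<le>n. c n k * y ^ k * x ^ (n - k)) * (x + y * q ^ n)"
    using Suc by (simp add: c_def)
  also have "\<dots> = (\<Sum>k\<le>n. c n k * y ^ k * x ^ (Suc n - k)) +
      (\<Sum>k\<le>n. q ^ n * c n k * y ^ Suc k * x ^ (n - k))"
    by (simp add: sum_distrib_left sum_distrib_right sum.distrib distrib_left Suc_diff_le
          mult_ac)
  also have "(\<Sum>k\<le>n. c n k * y ^ k * x ^ (Suc n - k)) =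
      (\<Sum>k\<le>Suc n. c n k * y ^ k * x ^ (Suc n - k))"
    by (simp add: cn)
  also have "\<dots> = x ^ Suc n + (\<Sum>k\<le>n. c n (Suc k) * y ^ Suc k * x ^ (n - k))"
    by (subst sum.atMost_Suc_shift) (simp add: c0)
  also have "\<dots> + (\<Sum>k\<le>n. q ^ n * c n k * y ^ Suc k * x ^ (n - k)) =
      x ^ Suc n + (\<Sum>k\<le>n. c (Suc n) (Suc k) * y ^ Suc k * x ^ (n - k))"
    by (simp add: cS algebra_simps sum.distrib)
  also have "\<dots> = (\<Sum>k\<le>Suc n. c (Suc n) k * y ^ k * x ^ (Suc n - k))"
    by (subst sum.atMost_Suc_shift) (simp add: c0)
  finally show ?case by (simp add: c_def)
qed

section \<open>The Jacobi triple product\<close>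

text \<open>
  The \<open>q\<close>-binomial theorem with \<open>2N+1\<close> factors, \<open>x = z q^N\<close> and \<open>y = 1\<close>, divided by
  \<open>z^(N+1)\<close> and a power of \<open>q\<close>. The odd number of factors makes the coefficients of \<open>z^m\<close> and \<open>z^(-m-1)\<close> equal.
\<close>
lemma finite_jacobi_triple_product:
  fixes q z :: complex
  assumes "norm q < 1" "q \<noteq> 0" "z \<noteq> 0"
  shows "qpoch (- z * q) q N * qpoch (- inverse z) q (Suc N) =
    (\<Sum>m\<le>N. qbinomial q (2 * N + 1) (N - m) *
       (q ^ (m * (m + 1) div 2) * (z ^ m + inverse z ^ Suc m)))"
proof -
  define T where "T = (\<lambda>m::nat. m * (m + 1) div 2)"
  have T0: "T 0 = 0" and TS: "T (Suc m) = T m + Suc m" for m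
    by (simp_all add: T_def)
  \<comment> \<open>The power of q extracted from the 2N+1 factors: \<open>N choose 2\<close> from
    those with k < N, and N (N+1) from the others.\<close>
  define e where "e = T N + N * N"
  define b where "b = qbinomial q (2 * N + 1)"
  have ch: "(k choose 2) + k = T k" for k
    by (induction k) (simp_all add: TS T0 numeral_2_eq_2)
  have T_add: "T (i + j) = T i + T j + i * j" for i j
    by (induction j) (simp_all add: TS T0)

  have T_double: "2 * T m = m * m + m" for m
    by (induction m) (simp_all add: TS T0)

  \<comment> \<open>For k < N the summand q^k is extracted, leaving 1 + z q^(N-k); read backwards
    these are the factors of (-zq; q)_N.\<close>
  have low: "(\<Prod>k<N. z * q ^ N + q ^ k) = q ^ (N choose 2) * qpoch (- z * q) q N"
  proof -
    have "(\<Prod>k<N. z * q ^ N + q ^ k) = (\<Prod>k<N. q ^ k * (1 + z * q * q ^ (N - Suc k)))"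
    proof (intro prod.cong refl)
      fix k assume "k \<in> {..<N}"
      hence "q ^ N = q ^ k * (q * q ^ (N - Suc k))"
        by (simp flip: power_add power_Suc)
      thus "z * q ^ N + q ^ k = q ^ k * (1 + z * q * q ^ (N - Suc k))"
        by (simp add: algebra_simps)
    qed
    also have "\<dots> = q ^ (\<Sum>k<N. k) * (\<Prod>k<N. 1 + z * q * q ^ (N - Suc k))"
      by (simp add: prod.distrib power_sum)
    also have "(\<Prod>k<N. 1 + z * q * q ^ (N - Suc k)) = qpoch (- z * q) q N"
      unfolding qpoch_def by (subst prod.nat_diff_reindex) simp
    also have "(\<Sum>k<N. k) = (N choose 2)"
      by (induction N) (simp_all add: numeral_2_eq_2)
    finally show ?thesis .
  qed
  \<comment> \<open>In the other N+1 factors the summand z q^N is extracted instead, leaving 1 +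
    z^(-1) q^k for k = 0, ..., N.\<close>
  have high: "(\<Prod>k<Suc N. z * q ^ N + q ^ (N + k)) =
      (z * q ^ N) ^ Suc N * qpoch (- inverse z) q (Suc N)"
  proof -
    have "(\<Prod>k<Suc N. z * q ^ N + q ^ (N + k)) = (\<Prod>k<Suc N. z * q ^ N * (1 + inverse z * q ^ k))"
      using assms(3) by (intro prod.cong refl) (simp add: power_add field_simps)
    thus ?thesis by (simp add: prod.distrib qpoch_def)
  qed
  have "(\<Prod>k<2 * N + 1. z * q ^ N + 1 * q ^ k) =
      (\<Prod>k<N. z * q ^ N + q ^ k) * (\<Prod>k<Suc N. z * q ^ N + q ^ (N + k))"
    using prod.nat_group[of "\<lambda>k. z * q ^ N + q ^ k" 1 1]
      prod.atLeastLessThan_concat[of 0 N "2 * N + 1" "\<lambda>k. z * q ^ N + q ^ k"]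
      prod.shift_bounds_nat_ivl[of "\<lambda>k. z * q ^ N + q ^ k" 0 N "Suc N"]
    by (simp add: atLeast0LessThan mult_2 add.commute del: prod.lessThan_Suc)
  also have "\<dots> = q ^ e * z ^ Suc N *
      (qpoch (- z * q) q N * qpoch (- inverse z) q (Suc N))"
  proof -
    have "q ^ (N choose 2) * (z * q ^ N) ^ Suc N = q ^ ((N choose 2) + N * Suc N) * z ^ Suc N"
      by (simp only: power_mult_distrib power_add power_mult mult_ac)
    also have "(N choose 2) + N * Suc N = e"
      using ch[of N] by (simp add: e_def)
    finally have 1: "q ^ (N choose 2) * (z * q ^ N) ^ Suc N = q ^ e * z ^ Suc N" .
    have 2: "u * v * (w * y) = (u * w) * (v * y)" for u v w y :: complex
      by (simp only: mult_ac)
    show ?thesis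
      unfolding low high 2[of "q ^ (N choose 2)" "qpoch (- z * q) q N"] 1 ..
  qed
  finally have lhs: "(\<Prod>k<2 * N + 1. z * q ^ N + 1 * q ^ k) = \<dots>" .

  define f where "f = (\<lambda>k. q ^ (k choose 2) * b k * 1 ^ k * (z * q ^ N) ^ (2 * N + 1 - k))"
  have "(\<Prod>k<2 * N + 1. z * q ^ N + 1 * q ^ k) = (\<Sum>k\<le>2 * N + 1. f k)"
    unfolding f_def b_def by (rule q_binomial_theorem[OF assms(1)])
  \<comment> \<open>Two halves of N+1 terms each. The index N - m carries z^(N+1+m) and the index
    N+1+m carries z^(N-m); relative to z^(N+1) these are z^m and z^(-m-1).\<close>
  also have "\<dots> = (\<Sum>k<Suc N. f k) + (\<Sum>k<Suc N. f (Suc N + k))"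
    using sum.atLeastLessThan_concat[of 0 "Suc N" "2 * N + 2" f]
      sum.shift_bounds_nat_ivl[of f 0 "Suc N" "Suc N"]
    by (simp add: atLeast0LessThan mult_2 add.commute lessThan_Suc_atMost[symmetric]
          del: sum.lessThan_Suc)
  also have "(\<Sum>k<Suc N. f k) = (\<Sum>m<Suc N. f (N - m))"
    using sum.nat_diff_reindex[of f "Suc N"] by simp
  also have "(\<Sum>m<Suc N. f (N - m)) =
      (\<Sum>m<Suc N. q ^ e * z ^ Suc N * (b (N - m) * (q ^ T m * z ^ m)))"
  proof (intro sum.cong refl)
    fix m assume "m \<in> {..<Suc N}"
    then obtain k where N: "N = k + m"
      using less_Suc_eq_le nat_le_iff_add by (metis add.commute lessThan_iff)
    have 1: "2 * N + 1 - k = Suc N + m" "N - m = k" using N by auto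
    \<comment> \<open>Measured from the middle of the sum, the quadratic exponent of q is the
      constant \<open>e\<close> plus a triangular number; the same happens in the other
      half.\<close>
    have 2: "(k choose 2) + N * (Suc N + m) = e + T m"
      using ch[of k] T_add[of k m] T_double[of m] unfolding e_def N by (simp add: algebra_simps)
    have "f k = b k * (q ^ ((k choose 2) + N * (Suc N + m)) * z ^ (Suc N + m))"
      unfolding f_def 1(1) by (simp only: power_mult_distrib power_add power_mult power_one mult_ac) simp
    thus "f (N - m) = q ^ e * z ^ Suc N * (b (N - m) * (q ^ T m * z ^ m))"
      unfolding 1(2) 2 by (simp only: power_add mult_ac)
  qed
  also have "(\<Sum>m<Suc N. f (Suc N + m)) =
      (\<Sum>m<Suc N. q ^ e * z ^ Suc N * (b (N - m) * (q ^ T m * inverse z ^ Suc m)))"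
  proof (intro sum.cong refl)
    fix m assume "m \<in> {..<Suc N}"
    then obtain k where N: "N = k + m"
      using less_Suc_eq_le nat_le_iff_add by (metis add.commute lessThan_iff)
    have 1: "2 * N + 1 - (Suc N + m) = k" "N - m = k" using N by auto
    have 2: "(Suc N + m choose 2) + N * k = e + T m"
      using ch[of "Suc N + m"] T_add[of "Suc N" m] TS[of N] unfolding e_def
      by (simp add: algebra_simps N)
    \<comment> \<open>The two indices add up to 2N+1, so both halves share their
      coefficients.\<close>
    have 3: "b (Suc N + m) = b (N - m)"
    proof -
      have "2 * N + 1 - k = Suc N + m" "k \<le> 2 * N + 1" using N by auto
      thus ?thesis
        using qbinomial_symmetric[of k "2 * N + 1" q] by (simp only: b_def 1(2))
    qed
    have 4: "z ^ k = z ^ Suc N * inverse z ^ Suc m"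
      using assms(3) by (simp add: N power_add field_simps)
    have "f (Suc N + m) = b (N - m) * (q ^ ((Suc N + m choose 2) + N * k) * z ^ k)"
      unfolding f_def 1(1) 3 by (simp only: power_mult_distrib power_add power_mult power_one mult_ac) simp
    thus "f (Suc N + m) = q ^ e * z ^ Suc N * (b (N - m) * (q ^ T m * inverse z ^ Suc m))"
      unfolding 2 4 by (simp only: power_add mult_ac)
  qed
  also have "(\<Sum>m<Suc N. q ^ e * z ^ Suc N * (b (N - m) * (q ^ T m * z ^ m))) + \<dots> =
      q ^ e * z ^ Suc N *
      (\<Sum>m<Suc N. b (N - m) * (q ^ T m * (z ^ m + inverse z ^ Suc m)))"
    by (simp only: sum_distrib_left sum.distrib distrib_left)
  finally have rhs: "(\<Prod>k<2 * N + 1. z * q ^ N + 1 * q ^ k) = \<dots>" .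
  have "q ^ e * z ^ Suc N \<noteq> 0" using assms by simp
  hence "qpoch (- z * q) q N * qpoch (- inverse z) q (Suc N) =
      (\<Sum>m<Suc N. b (N - m) * (q ^ T m * (z ^ m + inverse z ^ Suc m)))"
    using trans[OF lhs[symmetric] rhs] by (simp only: mult_cancel_left simp_thms)
  thus ?thesis
    unfolding b_def T_def lessThan_Suc_atMost .
qed

section \<open>Passage to the limit in the finite triple product\<close>

lemma summable_triangular_power:
  fixes q w :: complex
  assumes "norm q < 1"
  shows "summable (\<lambda>m. norm (q ^ (m * (m + 1) div 2) * w ^ m))"
proof -
  \<comment> \<open>The ratio of consecutive terms is q^(m+1) w, which tends to 0 however large w
    is, so the ratio test applies with constant 1/2.\<close>
  have "(\<lambda>m. norm q ^ Suc m * norm w) \<longlonglongrightarrow> 0 * norm w"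
    using assms by (intro tendsto_mult tendsto_const LIMSEQ_Suc LIMSEQ_power_zero) simp
  hence "eventually (\<lambda>m. norm q ^ Suc m * norm w < 1 / 2) sequentially"
    by (rule order_tendstoD) simp
  then obtain M where M: "norm q ^ Suc m * norm w < 1 / 2" if "m \<ge> M" for m
    by (auto simp: eventually_at_top_linorder)
  define f where "f = (\<lambda>m. q ^ (m * (m + 1) div 2) * w ^ m)"
  have "norm (f (Suc m)) \<le> 1 / 2 * norm (f m)" if "m \<ge> M" for m
  proof -
    have "Suc m * (Suc m + 1) div 2 = m * (m + 1) div 2 + Suc m"
      by simp
    hence "f (Suc m) = (q ^ Suc m * w) * f m"
      unfolding f_def by (simp only: power_add power_Suc mult_ac)
    hence "norm (f (Suc m)) = (norm q ^ Suc m * norm w) * norm (f m)"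
      by (simp only: norm_mult norm_power)
    also have "\<dots> \<le> 1 / 2 * norm (f m)"
      using M[OF that] by (intro mult_right_mono) auto
    finally show ?thesis .
  qed
  hence "summable (\<lambda>m. norm (f m))"
    by (intro summable_ratio_test[of "1 / 2" M]) auto
  thus ?thesis by (simp add: f_def)
qed

text \<open>(q; q)_n converges to a nonzero limit, so both it and its inverse are bounded. The bound
  is uniform in n and k, as dominated convergence of the finite identity requires.\<close>

lemma qbinomial_bounded:
  assumes "norm q < 1"
  obtains C where "\<And>n k. norm (qbinomial q n k) \<le> C"
proof -
  have lim: "qpoch q q \<longlonglongrightarrow> qpoch_inf q q"
    by (rule qpoch_tendsto[OF assms])
  have "Bseq (qpoch q q)"
    using lim by (intro convergent_imp_Bseq convergentI)
  then obtain A where A: "A > 0" "\<And>n. norm (qpoch q q n) \<le> A"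
    by (auto elim: BseqE)
  have "(\<lambda>n. inverse (qpoch q q n)) \<longlonglongrightarrow> inverse (qpoch_inf q q)"
    by (intro tendsto_inverse lim qpoch_inf_nonzero assms)
  hence "Bseq (\<lambda>n. inverse (qpoch q q n))"
    by (intro convergent_imp_Bseq convergentI)
  then obtain B where B: "B > 0" "\<And>n. norm (inverse (qpoch q q n)) \<le> B"
    by (auto elim: BseqE)
  have "norm (qbinomial q n k) \<le> A * (B * B)" for n k
  proof (cases "k \<le> n")
    case True
    hence "qbinomial q n k =
        qpoch q q n * (inverse (qpoch q q k) * inverse (qpoch q q (n - k)))"
      by (simp add: qbinomial_def field_simps)
    moreover have "norm \<dots> \<le> A * (B * B)"
      unfolding norm_mult using A B by (intro mult_mono) auto
    ultimately show ?thesis by simp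
  qed (use A B in \<open>simp add: qbinomial_def\<close>)
  thus ?thesis using that by blast
qed

text \<open>Let N tend to infinity in the finite identity. For fixed m the coefficient tends to 1 /
  (q; q)_\<infinity>, and Tannery's theorem allows the limit to be taken term by term.\<close>

theorem jacobi_triple_product:
  fixes q z :: complex
  assumes "norm q < 1" "q \<noteq> 0" "z \<noteq> 0"
  shows "(\<lambda>m. q ^ (m * (m + 1) div 2) * (z ^ m + inverse z ^ Suc m)) sums
    (qpoch_inf q q * qpoch_inf (- z * q) q * qpoch_inf (- inverse z) q)"
proof -
  define t where "t = (\<lambda>m. q ^ (m * (m + 1) div 2) * (z ^ m + inverse z ^ Suc m))"
  define L where "L = qpoch_inf q q"
  have L: "L \<noteq> 0" unfolding L_def by (intro qpoch_inf_nonzero assms)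
  \<comment> \<open>Padding with 0 for m > N turns each finite sum into a series over all m, the
    shape Tannery's theorem needs.\<close>
  define a where
    "a = (\<lambda>m N. if m \<le> N then qbinomial q (2 * N + 1) (N - m) * t m else 0)"
  obtain C where C: "\<And>n k. norm (qbinomial q n k) \<le> C"
    using qbinomial_bounded[OF assms(1)] by blast
  have C0: "C \<ge> 0" using C[of 0 0] norm_ge_zero order_trans by blast
  have s: "summable (\<lambda>m. norm q ^ (m * (m + 1) div 2) * norm w ^ m)" for w :: complex
    using summable_triangular_power[OF assms(1), of w] by (simp add: norm_mult norm_power)
  have sm: "summable (\<lambda>m. norm (t m))"
  proof (rule summable_comparison_test)
    show "summable (\<lambda>m. norm q ^ (m * (m + 1) div 2) * norm z ^ m +
        norm (inverse z) * (norm q ^ (m * (m + 1) div 2) * norm (inverse z) ^ m))"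
      by (intro summable_add summable_mult s)
    have "norm (norm (t m)) \<le> norm q ^ (m * (m + 1) div 2) * norm z ^ m +
        norm (inverse z) * (norm q ^ (m * (m + 1) div 2) * norm (inverse z) ^ m)" for m
    proof -
      have "norm (norm (t m)) = norm q ^ (m * (m + 1) div 2) * norm (z ^ m + inverse z ^ Suc m)"
        by (simp add: t_def norm_mult norm_power)
      also have "\<dots> \<le> norm q ^ (m * (m + 1) div 2) * (norm (z ^ m) + norm (inverse z ^ Suc m))"
        by (intro mult_left_mono norm_triangle_ineq) auto
      finally show ?thesis
        by (simp add: norm_power norm_mult distrib_left mult_ac)
    qed
    thus "\<exists>N. \<forall>m\<ge>N. norm (norm (t m)) \<le> norm q ^ (m * (m + 1) div 2) * norm z ^ m +
        norm (inverse z) * (norm q ^ (m * (m + 1) div 2) * norm (inverse z) ^ m)"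
      by blast
  qed
  have "(\<lambda>N. a m N) \<longlonglongrightarrow> inverse L * t m" for m
  proof -
    have P: "qpoch q q \<longlonglongrightarrow> L" unfolding L_def by (rule qpoch_tendsto[OF assms(1)])
    \<comment> \<open>The three indices N - m, N + m + 1 and 2N + 1 are all at least N - m, so one
      statement serves for each of them.\<close>
    have *: "(\<lambda>N. qpoch q q (g N)) \<longlonglongrightarrow> L" if "\<And>N. N - m \<le> g N" for g
    proof (rule filterlim_compose[OF P])
      show "filterlim g at_top sequentially"
        by (rule filterlim_at_top_mono[OF filterlim_minus_const_nat_at_top[of m]])
           (auto intro!: always_eventually that)
    qed
    have "(\<lambda>N. qpoch q q (2 * N + 1) / (qpoch q q (N - m) * qpoch q q (N + m + 1)) * t m)
        \<longlonglongrightarrow> L / (L * L) * t m"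
      using L by (intro tendsto_intros *) auto
    hence lim: "(\<lambda>N. qpoch q q (2 * N + 1) / (qpoch q q (N - m) * qpoch q q (N + m + 1)) * t m)
        \<longlonglongrightarrow> inverse L * t m"
      using L by (simp add: field_simps)
    show ?thesis
    proof (rule Lim_transform_eventually[OF lim])
      show "eventually (\<lambda>N. qpoch q q (2 * N + 1) /
          (qpoch q q (N - m) * qpoch q q (N + m + 1)) * t m = a m N) sequentially"
        using eventually_ge_at_top[of m]
      proof eventually_elim
        case (elim N)
        hence "2 * N + 1 - (N - m) = N + m + 1" by simp
        thus ?case using elim by (simp add: a_def qbinomial_def)
      qed
    qed
  qed
  moreover have "eventually (\<lambda>(m, N). norm (a m N) \<le> C * norm (t m))
      (at_top \<times>\<^sub>F sequentially)"
    using C C0 by (auto intro!: always_eventually mult_right_mono simp: a_def norm_mult)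
  ultimately have "(\<lambda>N. \<Sum>m. a m N) \<longlonglongrightarrow> (\<Sum>m. inverse L * t m)"
    using tannerys_theorem[of a "\<lambda>m. inverse L * t m" sequentially "\<lambda>m. C * norm (t m)"]
      summable_mult[OF sm, of C] by auto
  moreover have "(\<Sum>m. a m N) = qpoch (- z * q) q N * qpoch (- inverse z) q (Suc N)" for N
  proof -
    have "(\<Sum>m. a m N) = (\<Sum>m\<le>N. a m N)"
      by (rule suminf_finite) (auto simp: a_def)
    also have "\<dots> = (\<Sum>m\<le>N. qbinomial q (2 * N + 1) (N - m) * t m)"
      by (simp add: a_def)
    finally show ?thesis
      using finite_jacobi_triple_product[OF assms, of N] by (simp only: t_def)
  qed
  moreover have "(\<lambda>N. qpoch (- z * q) q N * qpoch (- inverse z) q (Suc N))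
      \<longlonglongrightarrow> qpoch_inf (- z * q) q * qpoch_inf (- inverse z) q"
    by (intro tendsto_mult qpoch_tendsto LIMSEQ_Suc assms)
  ultimately have "(\<Sum>m. inverse L * t m) = qpoch_inf (- z * q) q * qpoch_inf (- inverse z) q"
    using LIMSEQ_unique by auto
  moreover have "summable t" using sm by (rule summable_norm_cancel)
  ultimately have "inverse L * suminf t = qpoch_inf (- z * q) q * qpoch_inf (- inverse z) q"
    by (simp only: suminf_mult)
  hence "suminf t = L * (qpoch_inf (- z * q) q * qpoch_inf (- inverse z) q)"
    using L by (metis mult.assoc mult.left_neutral right_inverse)
  thus ?thesis
    using summable_sums[OF \<open>summable t\<close>] by (simp add: t_def L_def mult.assoc)
qed


section \<open>Product identities and the two specialisations\<close>

text \<open>Used to detach the constant factor 1 + \<omega>^2 = -\<omega> in the cube root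
  specialisation.\<close>

lemma qpoch_inf_head:
  assumes "norm q < 1"
  shows "qpoch_inf a q = (1 - a) * qpoch_inf (a * q) q"
proof -
  have "qpoch a q (Suc n) = (1 - a) * qpoch (a * q) q n" for n
    by (induction n) (simp_all add: qpoch_Suc mult_ac)
  hence "(\<lambda>n. (1 - a) * qpoch (a * q) q n) \<longlonglongrightarrow> qpoch_inf a q"
    using LIMSEQ_Suc[OF qpoch_tendsto[OF assms, of a]] by simp
  moreover have "(\<lambda>n. (1 - a) * qpoch (a * q) q n) \<longlonglongrightarrow> (1 - a) * qpoch_inf (a * q) q"
    by (intro tendsto_intros qpoch_tendsto assms)
  ultimately show ?thesis by (rule LIMSEQ_unique)
qed

lemma norm_power_less_1:
  fixes q :: complex
  assumes "norm q < 1" "k > 0"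
  shows "norm (q ^ k) < 1"
  using assms by (simp add: norm_power power_less_one_iff)

text \<open>The factors are sorted by k modulo 3; the limit is taken along the partial products of
  length 3n.\<close>

lemma qpoch_inf_trisect:
  assumes "norm q < 1"
  shows "qpoch_inf a q =
    qpoch_inf a (q ^ 3) * qpoch_inf (a * q) (q ^ 3) * qpoch_inf (a * q ^ 2) (q ^ 3)"
proof -
  have q3: "norm (q ^ 3) < 1" by (rule norm_power_less_1[OF assms]) simp
  have "qpoch a q (3 * n) =
      qpoch a (q ^ 3) n * qpoch (a * q) (q ^ 3) n * qpoch (a * q ^ 2) (q ^ 3) n" for n
  proof (induction n)
    case (Suc n)
    have "qpoch a q (3 * Suc n) = qpoch a q (3 * n) *
        (1 - a * (q ^ 3) ^ n) * (1 - a * q * (q ^ 3) ^ n) * (1 - a * q ^ 2 * (q ^ 3) ^ n)"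
    proof -
      have 1: "3 * Suc n = Suc (Suc (Suc (3 * n)))" by simp
      show ?thesis
        unfolding 1 qpoch_Suc power_Suc power_mult power2_eq_square
        by (simp only: mult_ac)
    qed
    thus ?case
      unfolding Suc by (simp only: qpoch_Suc mult_ac)
  qed simp
  moreover have "(\<lambda>n. qpoch a q (3 * n)) \<longlonglongrightarrow> qpoch_inf a q"
    by (rule filterlim_compose[OF qpoch_tendsto[OF assms]])
       (auto intro!: filterlim_subseq strict_monoI)
  ultimately have "(\<lambda>n. qpoch a (q ^ 3) n * qpoch (a * q) (q ^ 3) n * qpoch (a * q ^ 2) (q ^ 3) n)
      \<longlonglongrightarrow> qpoch_inf a q"
    by simp
  moreover have "(\<lambda>n. qpoch a (q ^ 3) n * qpoch (a * q) (q ^ 3) n * qpoch (a * q ^ 2) (q ^ 3) n)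
      \<longlonglongrightarrow> qpoch_inf a (q ^ 3) * qpoch_inf (a * q) (q ^ 3) * qpoch_inf (a * q ^ 2) (q ^ 3)"
    by (intro tendsto_intros qpoch_tendsto q3)
  ultimately show ?thesis by (rule LIMSEQ_unique)
qed

text \<open>Factorwise difference of squares; it reduces eta at doubled arguments to the undoubled
  ones.\<close>

lemma qpoch_inf_square:
  assumes "norm q < 1"
  shows "qpoch_inf (q ^ 2) (q ^ 2) = qpoch_inf q q * qpoch_inf (- q) q"
proof -
  have "(1 - q * q ^ k) * (1 - (- q) * q ^ k) = 1 - q ^ 2 * (q ^ 2) ^ k" for k
    by (simp add: algebra_simps power2_eq_square power_mult_distrib)
  thus ?thesis
    unfolding qpoch_inf_def by (simp only: prodinf_mult convergent_prod_qpoch[OF assms])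
qed

lemma qpoch_inf_cube_roots:
  assumes "norm q < 1" "\<omega>\<^sup>2 + \<omega> + 1 = 0"
  shows "qpoch_inf (a ^ 3) (q ^ 3) =
    qpoch_inf a q * qpoch_inf (\<omega> * a) q * qpoch_inf (\<omega>\<^sup>2 * a) q"
proof -
  have "(1 - x) * (1 - \<omega> * x) * (1 - \<omega>\<^sup>2 * x) = 1 - x ^ 3" for x
  proof -
    \<comment> \<open>With s = \<omega>^2 + \<omega> + 1, the coefficients of x, x^2 and x^3 in the
      difference are -s, \<omega> s and 1 - \<omega>^3 = -(\<omega> - 1) s.\<close>
    have "(1 - x) * (1 - \<omega> * x) * (1 - \<omega>\<^sup>2 * x) - (1 - x ^ 3) =
        (\<omega>\<^sup>2 + \<omega> + 1) * (\<omega> * x\<^sup>2 - x - (\<omega> - 1) * x ^ 3)"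
      by (simp add: algebra_simps power2_eq_square power3_eq_cube)
    thus ?thesis using assms(2) by simp
  qed
  hence "(1 - a * q ^ k) * (1 - \<omega> * a * q ^ k) * (1 - \<omega>\<^sup>2 * a * q ^ k) =
      1 - a ^ 3 * (q ^ 3) ^ k" for k
    by (simp add: power_mult_distrib mult.assoc flip: power_mult) (simp add: mult.commute)
  thus ?thesis
    unfolding qpoch_inf_def
    by (simp only: prodinf_mult convergent_prod_mult convergent_prod_qpoch[OF assms(1)])
qed

section \<open>Translating eta values, Legendre symbols and triangular exponents\<close>

lemma dedekind_eta_mult:
  "dedekind_eta (of_nat k * \<tau>) = exp (2 * of_real pi * \<i> * \<tau> / 24) ^ k *
     qpoch_inf (exp (2 * of_real pi * \<i> * \<tau>) ^ k) (exp (2 * of_real pi * \<i> * \<tau>) ^ k)"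
proof -
  have "2 * of_real pi * \<i> * (of_nat k * \<tau>) / 24 = of_nat k * (2 * of_real pi * \<i> * \<tau> / 24)"
    and "2 * of_real pi * \<i> * (of_nat k * \<tau>) = of_nat k * (2 * of_real pi * \<i> * \<tau>)"
    by simp_all
  thus ?thesis
    \<comment> \<open>The exponent \<open>Suc n\<close> in the eta product supplies the extra factor
      that becomes the first argument of \<open>qpoch_inf\<close>.\<close>
    unfolding dedekind_eta_def qpoch_inf_def by (simp only: exp_of_nat_mult power_Suc)
qed

text \<open>The symbol vanishes exactly when 3 divides n + 2; squaring removes the sign, so
  quadratic residues need not be determined.\<close>

lemma Legendre_3_power2: "(Legendre (int n + 2) 3)\<^sup>2 = (if n mod 3 = 1 then 0 else 1)"
proof -
  have "[int n + 2 = 0] (mod 3) \<longleftrightarrow> n mod 3 = 1"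
    unfolding cong_def by presburger
  thus ?thesis by (simp add: Legendre_def)
qed

text \<open>Matches the exponents of index 3m and 3m+2 with base q^9. In the first equation 3m
  stands on the left to avoid subtraction of natural numbers.\<close>

lemma triangular_trisect:
  fixes m :: nat
  shows "3 * m * (3 * m + 1) div 2 + 3 * m = 9 * (m * (m + 1) div 2)"
    and "(3 * m + 2) * (3 * m + 2 + 1) div 2 = 9 * (m * (m + 1) div 2) + 3 * Suc m"
proof -
  have "even (m * (m + 1))" by simp
  then obtain t where t: "m * (m + 1) = 2 * t" by (rule evenE)
  have "3 * m * (3 * m + 1) + 2 * (3 * m) = 2 * (9 * t)"
    and "(3 * m + 2) * (3 * m + 2 + 1) = 2 * (9 * t + 3 * Suc m)"
    using t by (simp_all add: algebra_simps)
  thus "3 * m * (3 * m + 1) div 2 + 3 * m = 9 * (m * (m + 1) div 2)"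
    and "(3 * m + 2) * (3 * m + 2 + 1) div 2 = 9 * (m * (m + 1) div 2) + 3 * Suc m"
    unfolding t by simp_all
qed

lemma summable_bounded_triangular_power:
  fixes q :: complex and c :: "nat \<Rightarrow> complex"
  assumes "norm q < 1" "\<And>n. norm (c n) \<le> C"
  shows "summable (\<lambda>n. c n * q ^ (n * (n + 1) div 2))"
proof (rule summable_comparison_test)
  show "summable (\<lambda>n. C * norm (q ^ (n * (n + 1) div 2) * 1 ^ n))"
    by (intro summable_mult summable_triangular_power assms)
  show "\<exists>N. \<forall>n\<ge>N. norm (c n * q ^ (n * (n + 1) div 2)) \<le>
      C * norm (q ^ (n * (n + 1) div 2) * 1 ^ n)"
    using assms(2) by (auto simp: norm_mult intro!: mult_right_mono)
qed

text \<open>With x = q^3 the triple product yields (x^3; x^3)(-x^2; x^3)(-x; x^3), all of infinite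
  length. The factor (-x^3; x^3) supplies the missing residue class and completes the last two to
  (-x; x).\<close>

lemma suminf_triangular_not_1_mod_3:
  fixes q :: complex
  assumes "norm q < 1" "q \<noteq> 0"
  shows "(\<Sum>n. (if n mod 3 = 1 then 0 else 1) * q ^ (n * (n + 1) div 2)) =
    qpoch_inf (q ^ 9) (q ^ 9) * qpoch_inf (- (q ^ 3)) (q ^ 3) / qpoch_inf (- (q ^ 9)) (q ^ 9)"
proof -
  define f where "f = (\<lambda>n::nat. (if n mod 3 = 1 then 0 else 1) * q ^ (n * (n + 1) div 2))"
  define x where "x = q ^ 3"
  have x: "norm x < 1" "x \<noteq> 0" and x3: "norm (x ^ 3) < 1" "x ^ 3 = q ^ 9"
    using norm_power_less_1[OF assms(1)] assms(2) by (simp_all add: x_def flip: power_mult)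
  have "f sums suminf f"
    unfolding f_def by (intro summable_sums summable_bounded_triangular_power[of _ _ 1] assms) auto
  hence "(\<lambda>m. sum f {m * 3..<m * 3 + 3}) sums suminf f"
    by (rule sums_group) simp
  \<comment> \<open>The middle term of each block of three vanishes.
    \<open>inverse (inverse x)\<close> is kept so that the term is literally that of the triple
    product at z = \<open>inverse x\<close>.\<close>
  moreover have "sum f {m * 3..<m * 3 + 3} =
      (x ^ 3) ^ (m * (m + 1) div 2) * (inverse x ^ m + inverse (inverse x) ^ Suc m)" for m
  proof -
    have "{m * 3..<m * 3 + 3} = {3 * m, 3 * m + 1, 3 * m + 2}" by auto
    moreover have "(3 * m + 1) mod 3 = 1" "(3 * m + 2) mod 3 = 2" by presburger+
    ultimately have "sum f {m * 3..<m * 3 + 3} =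
        q ^ (3 * m * (3 * m + 1) div 2) + q ^ ((3 * m + 2) * (3 * m + 2 + 1) div 2)"
      by (simp add: f_def)
    moreover have "q ^ (3 * m * (3 * m + 1) div 2) * x ^ m = (x ^ 3) ^ (m * (m + 1) div 2)"
      using triangular_trisect(1)[of m] by (simp only: x_def flip: power_mult power_add) simp
    hence "q ^ (3 * m * (3 * m + 1) div 2) = (x ^ 3) ^ (m * (m + 1) div 2) * inverse x ^ m"
      using x(2) by (simp add: field_simps)
    moreover have "q ^ ((3 * m + 2) * (3 * m + 2 + 1) div 2) =
        (x ^ 3) ^ (m * (m + 1) div 2) * inverse (inverse x) ^ Suc m"
      unfolding triangular_trisect(2) inverse_inverse_eq
      by (simp only: x_def flip: power_mult power_add) simp
    ultimately show ?thesis by (simp only: distrib_left)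
  qed
  moreover have "(\<lambda>m. (x ^ 3) ^ (m * (m + 1) div 2) * (inverse x ^ m + inverse (inverse x) ^ Suc m))
      sums (qpoch_inf (x ^ 3) (x ^ 3) *
      qpoch_inf (- inverse x * x ^ 3) (x ^ 3) * qpoch_inf (- inverse (inverse x)) (x ^ 3))"
    by (rule jacobi_triple_product) (use x x3(1) in auto)
  ultimately have "suminf f = qpoch_inf (x ^ 3) (x ^ 3) *
      qpoch_inf (- inverse x * x ^ 3) (x ^ 3) * qpoch_inf (- inverse (inverse x)) (x ^ 3)"
    by (simp only: sums_unique2)
  also have "- inverse x * x ^ 3 = - x * x"
    using x(2) by (simp add: power3_eq_cube)
  finally have "suminf f * qpoch_inf (- (x ^ 3)) (x ^ 3) =
      qpoch_inf (x ^ 3) (x ^ 3) * qpoch_inf (- x) x"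
    using qpoch_inf_trisect[OF x(1), of "- x"] by (simp add: power3_eq_cube power2_eq_square mult_ac)
  moreover have "qpoch_inf (- (x ^ 3)) (x ^ 3) \<noteq> 0"
    using x3(1) by (intro qpoch_inf_nonzero) auto
  ultimately show ?thesis
    unfolding f_def x3(2)[symmetric] x_def[symmetric] by (simp add: field_simps)
qed

text \<open>At z = \<omega> the head factor of the last product cancels the -\<omega> in the
  coefficients. The two remaining products with \<omega> and \<omega>^2 are completed by (-q; q) to
  (-q^3; q^3), again of infinite length.\<close>

lemma suminf_triangular_cube_root:
  fixes q :: complex
  assumes "norm q < 1" "q \<noteq> 0"
  shows "(\<Sum>n. (if n mod 3 = 1 then - 2 else 1) * q ^ (n * (n + 1) div 2)) =
    qpoch_inf q q * qpoch_inf (- (q ^ 3)) (q ^ 3) / qpoch_inf (- q) q"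
proof -
  define f where "f = (\<lambda>n::nat. (if n mod 3 = 1 then - 2 else 1) * q ^ (n * (n + 1) div 2))"
  define \<omega> where "\<omega> = Complex (- 1 / 2) (sqrt 3 / 2)"
  have w: "\<omega>\<^sup>2 + \<omega> + 1 = 0"
    by (simp add: \<omega>_def complex_eq_iff power2_eq_square)
  have w0: "\<omega> \<noteq> 0" using w by auto
  have w2: "\<omega>\<^sup>2 = - \<omega> - 1" using w by (simp add: eq_diff_eq eq_neg_iff_add_eq_0 add_ac)
  have "\<omega> ^ 3 - 1 = (\<omega>\<^sup>2 + \<omega> + 1) * (\<omega> - 1)"
    by (simp add: algebra_simps power2_eq_square power3_eq_cube)
  hence w3: "\<omega> ^ 3 = 1" using w by simp
  have w4: "(\<omega>\<^sup>2)\<^sup>2 = \<omega>"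
  proof -
    have "(\<omega>\<^sup>2)\<^sup>2 = \<omega> ^ 3 * \<omega>"
      by (simp add: power2_eq_square power3_eq_cube)
    thus ?thesis by (simp add: w3)
  qed
  have w1: "1 + \<omega>\<^sup>2 = - \<omega>" by (simp add: w2)
  have winv: "inverse \<omega> = \<omega>\<^sup>2"
    using w3 by (intro inverse_unique) (simp add: power3_eq_cube power2_eq_square mult.assoc)
  have "f sums suminf f"
    unfolding f_def by (intro summable_sums summable_bounded_triangular_power[of _ _ 2] assms) auto
  hence "(\<lambda>m. - \<omega> * f m) sums (- \<omega> * suminf f)"
    by (rule sums_mult)
  moreover have "- \<omega> * f m = q ^ (m * (m + 1) div 2) * (\<omega> ^ m + inverse \<omega> ^ Suc m)" for m
  proof -
    have m: "\<omega> ^ m = \<omega> ^ (m mod 3)"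
    proof -
      have "\<omega> ^ (m mod 3 + 3 * (m div 3)) = \<omega> ^ (m mod 3)"
        by (simp only: power_add power_mult w3 power_one mult_1_right)
      thus ?thesis by simp
    qed
    \<comment> \<open>As \<omega>^(-1) = \<omega>^2, this power too depends only on m modulo 3. The
      three coefficients are 1 + \<omega>^2 = -\<omega>, \<omega> + \<omega> = 2\<omega> and
      \<omega>^2 + 1 = -\<omega>.\<close>
    have i: "inverse \<omega> ^ Suc m = \<omega>\<^sup>2 * (\<omega> ^ (m mod 3)) ^ 2"
      unfolding winv m[symmetric] by (simp add: power_mult_distrib flip: power_mult) (simp add: mult.commute)
    consider "m mod 3 = 0" | "m mod 3 = 1" | "m mod 3 = 2" by linarith
    hence "- \<omega> * (if m mod 3 = 1 then - 2 else 1) = \<omega> ^ m + inverse \<omega> ^ Suc m"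
    proof cases
      case 1
      thus ?thesis unfolding m i by (simp add: w1)
    next
      case 2
      thus ?thesis unfolding m i by (simp add: w4 del: power_mult_numeral flip: power2_eq_square)
    next
      case 3
      have "\<omega>\<^sup>2 * \<omega> = 1" "\<omega>\<^sup>2 + 1 = - \<omega>"
        using w3 w1 by (simp_all add: power2_eq_square power3_eq_cube add.commute)
      thus ?thesis unfolding m i 3 w4 by simp
    qed
    moreover have "- \<omega> * f m =
        q ^ (m * (m + 1) div 2) * (- \<omega> * (if m mod 3 = 1 then - 2 else 1))"
      by (simp only: f_def mult_ac)
    ultimately show ?thesis by simp
  qed
  ultimately have "- \<omega> * suminf f =
      qpoch_inf q q * qpoch_inf (- \<omega> * q) q * qpoch_inf (- inverse \<omega>) q"
    using sums_unique2[OF _ jacobi_triple_product[OF assms w0]] by (simp only:)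
  also have "qpoch_inf (- inverse \<omega>) q = - \<omega> * qpoch_inf (\<omega>\<^sup>2 * (- q)) q"
    using qpoch_inf_head[OF assms(1), of "- \<omega>\<^sup>2"] w1 by (simp add: winv)
  finally have "suminf f = qpoch_inf q q * qpoch_inf (\<omega> * (- q)) q * qpoch_inf (\<omega>\<^sup>2 * (- q)) q"
    using w0 by simp
  hence "suminf f * qpoch_inf (- q) q = qpoch_inf q q * qpoch_inf (- (q ^ 3)) (q ^ 3)"
    using qpoch_inf_cube_roots[OF assms(1) w, of "- q"] by (simp add: mult_ac)
  moreover have "qpoch_inf (- q) q \<noteq> 0"
    using assms by (intro qpoch_inf_nonzero) auto
  ultimately show ?thesis
    unfolding f_def by (simp add: field_simps)
qed

text \<open>Each eta value is a power of r = e^(2 pi i \<tau> / 24) times an Euler product. The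
  powers of r collect to the prefactor, and the Euler products reduce to the two evaluated series.
  Summability is asserted separately because \<open>suminf\<close> alone does not express
  convergence.\<close>

theorem theorem2p5:
  fixes \<tau> q q8 :: complex
  assumes "Im \<tau> > 0"
    and "q = exp (2 * of_real pi * \<i> * \<tau>)"
    and "q8 = exp (2 * of_real pi * \<i> * \<tau> / 8)"
  shows "(summable (\<lambda>n::nat. of_int ((Legendre (int n + 2) 3)\<^sup>2) * q ^ (n * (n + 1) div 2)) \<and>
          dedekind_eta (6 * \<tau>) * dedekind_eta (9 * \<tau>) ^ 2 /
            (dedekind_eta (3 * \<tau>) * dedekind_eta (18 * \<tau>)) =
          q8 * (\<Sum>n::nat. of_int ((Legendre (int n + 2) 3)\<^sup>2) * q ^ (n * (n + 1) div 2))) \<and>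
         (summable (\<lambda>n::nat. of_int (3 * (Legendre (int n + 2) 3)\<^sup>2 - 2) * q ^ (n * (n + 1) div 2)) \<and>
          dedekind_eta \<tau> ^ 2 * dedekind_eta (6 * \<tau>) /
            (dedekind_eta (2 * \<tau>) * dedekind_eta (3 * \<tau>)) =
          q8 * (\<Sum>n::nat. of_int (3 * (Legendre (int n + 2) 3)\<^sup>2 - 2) * q ^ (n * (n + 1) div 2)))"
proof -
  have q: "norm q < 1" "q \<noteq> 0"
    using norm_nome_less_1[OF assms(1)] by (simp_all add: assms(2))
  define r where "r = exp (2 * of_real pi * \<i> * \<tau> / 24)"
  define E where "E = (\<lambda>k. qpoch_inf (q ^ k) (q ^ k))"
  define G where "G = (\<lambda>k. qpoch_inf (- (q ^ k)) (q ^ k))"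
  have r0: "r \<noteq> 0" by (simp add: r_def)
  have r3: "q8 = r ^ 3"
    by (simp add: r_def assms(3) flip: exp_of_nat_mult)
  have nz: "E k \<noteq> 0" "G k \<noteq> 0" if "k > 0" for k
    unfolding E_def G_def using norm_power_less_1[OF q(1) that]
    by (simp_all add: qpoch_inf_nonzero)
  have E2: "E (2 * k) = E k * G k" if "k > 0" for k
    unfolding E_def G_def using qpoch_inf_square[OF norm_power_less_1[OF q(1) that]]
    by (simp add: mult.commute flip: power_mult)
  have eta: "dedekind_eta (of_nat k * \<tau>) = r ^ k * E k" for k
    unfolding dedekind_eta_mult r_def E_def assms(2) ..
  note etas = eta[of 1, simplified] eta[of 2, simplified] eta[of 3, simplified]
    eta[of 6, simplified] eta[of 9, simplified] eta[of 18, simplified]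
  note Es = E2[of 1, simplified] E2[of 3, simplified] E2[of 9, simplified]
  have c1: "of_int ((Legendre (int n + 2) 3)\<^sup>2) = (if n mod 3 = 1 then 0 else 1 :: complex)"
    and c2: "of_int (3 * (Legendre (int n + 2) 3)\<^sup>2 - 2) = (if n mod 3 = 1 then - 2 else 1 :: complex)"
    for n
    unfolding Legendre_3_power2 by simp_all
  have "dedekind_eta (6 * \<tau>) * dedekind_eta (9 * \<tau>) ^ 2 /
      (dedekind_eta (3 * \<tau>) * dedekind_eta (18 * \<tau>)) =
      (r ^ 6 * (r ^ 9) ^ 2 / (r ^ 3 * r ^ 18)) * (E 6 * E 9 ^ 2 / (E 3 * E 18))"
    unfolding etas power_mult_distrib by (simp add: mult_ac)
  \<comment> \<open>6 + 18 - 3 - 18 = 3, and 3/24 = 1/8.\<close>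
  also have "r ^ 6 * (r ^ 9) ^ 2 / (r ^ 3 * r ^ 18) = q8"
    using r0 by (simp add: r3 divide_simps flip: power_mult power_add)
  \<comment> \<open>E 6 = E 3 * G 3 and E 18 = E 9 * G 9 cancel all but these three
    products.\<close>
  also have "E 6 * E 9 ^ 2 / (E 3 * E 18) = E 9 * G 3 / G 9"
    using nz[of 3] nz[of 9] by (simp add: Es divide_simps power2_eq_square)
  also have "\<dots> = (\<Sum>n. (if n mod 3 = 1 then 0 else 1) * q ^ (n * (n + 1) div 2))"
    unfolding E_def G_def by (rule suminf_triangular_not_1_mod_3[OF q, symmetric])
  finally have 1: "dedekind_eta (6 * \<tau>) * dedekind_eta (9 * \<tau>) ^ 2 /
      (dedekind_eta (3 * \<tau>) * dedekind_eta (18 * \<tau>)) = q8 * \<dots>" .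
  have "dedekind_eta \<tau> ^ 2 * dedekind_eta (6 * \<tau>) /
      (dedekind_eta (2 * \<tau>) * dedekind_eta (3 * \<tau>)) =
      (r ^ 2 * r ^ 6 / (r ^ 2 * r ^ 3)) * (E 1 ^ 2 * E 6 / (E 2 * E 3))"
    unfolding etas power_mult_distrib by (simp add: mult_ac)
  also have "r ^ 2 * r ^ 6 / (r ^ 2 * r ^ 3) = q8"
    using r0 by (simp add: r3 divide_simps flip: power_mult power_add)
  \<comment> \<open>Here the doublings used are E 6 = E 3 * G 3 and E 2 = E 1 * G 1.\<close>
  also have "E 1 ^ 2 * E 6 / (E 2 * E 3) = E 1 * G 3 / G 1"
    using nz[of 1] nz[of 3] by (simp add: Es divide_simps power2_eq_square)
  also have "\<dots> = (\<Sum>n. (if n mod 3 = 1 then - 2 else 1) * q ^ (n * (n + 1) div 2))"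
    unfolding E_def G_def power_one_right
    by (rule suminf_triangular_cube_root[OF q, symmetric])
  finally have 2: "dedekind_eta \<tau> ^ 2 * dedekind_eta (6 * \<tau>) /
      (dedekind_eta (2 * \<tau>) * dedekind_eta (3 * \<tau>)) = q8 * \<dots>" .
  show ?thesis
    unfolding c1 c2
    by (intro conjI 1 2 summable_bounded_triangular_power[of _ _ 2] q) auto
qed

end
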